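(* Let $G$ be a planar graph with maximum degree $\Delta$ and girth $g(G)$. Then $\chi'_{ur}(G)\le 2\Delta+4$ if $g(G)=7$, and $\chi'_{ur}(G)\le 2\Delta+2$ if $g(G)\ge 8$.
   Context: Graphs are finite, undirected and simple. The girth $g(G)$ is the length of a shortest cycle of $G$ (with the usual convention $g(G)=\infty$ if $G$ has no cycle). A matching $M$ of $G$ is a set of pairwise disjoint edges; $G_M$ denotes the subgraph of $G$ induced by the vertices covered by $M$. A matching $M$ of $G$ is uniquely restricted if $M$ is the unique perfect matching of $G_M$. A uniquely restricted edge coloring of $G$ is an assignment of colors to the edges of $G$ such that every color class is a uniquely restricted matching of $G$. The uniquely restricted chromatic index $\chi'_{ur}(G)$ is the minimum number of colors in a uniquely restricted edge coloring of $G$. *)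

theory Defs
  imports "HOL-Analysis.Analysis" "HOL-Library.Extended_Nat"
begin

type_synonym 'a graph = "'a set \<times> 'a set set"

abbreviation verts :: "'a graph \<Rightarrow> 'a set" where
  "verts \<equiv> fst"

abbreviation edges :: "'a graph \<Rightarrow> 'a set set" where
  "edges \<equiv> snd"

definition simple_graph :: "'a graph \<Rightarrow> bool" where
  "simple_graph G \<longleftrightarrow>
     finite (verts G) \<and> (\<forall>e \<in> edges G. e \<subseteq> verts G \<and> card e = 2)"

definition degree :: "'a graph \<Rightarrow> 'a \<Rightarrow> nat" where
  "degree G v = card {e \<in> edges G. v \<in> e}"

text \<open>The \<open>0\<close> only matters for the graph without vertices, whose maximum degree is thereby \<open>0\<close>.\<close>

definition max_degree :: "'a graph \<Rightarrow> nat" where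
  "max_degree G = Max (insert 0 (degree G ` verts G))"

text \<open>A cycle is given by the list of its vertices in cyclic order, without repeating the
  first vertex at the end; its length is then the length of the list.\<close>

definition is_cycle :: "'a graph \<Rightarrow> 'a list \<Rightarrow> bool" where
  "is_cycle G xs \<longleftrightarrow>
     3 \<le> length xs \<and> distinct xs \<and>
     (\<forall>i < length xs. {xs ! i, xs ! (Suc i mod length xs)} \<in> edges G)"

text \<open>The infimum of the empty set in \<^typ>\<open>enat\<close> is \<open>\<infinity>\<close>, the girth of an acyclic graph.\<close>

definition girth :: "'a graph \<Rightarrow> enat" where
  "girth G = (INF xs \<in> {xs. is_cycle G xs}. enat (length xs))"

text \<open>Planarity means having a crossing-free drawing in the plane (here \<^typ>\<open>complex\<close>, as in the
  library's Jordan curve theorem): \<open>p\<close> places the vertices and the simple arc \<open>\<gamma> e\<close> draws the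
  edge \<open>e\<close>.\<close>

definition plane_drawing ::
    "'a graph \<Rightarrow> ('a \<Rightarrow> complex) \<Rightarrow> ('a set \<Rightarrow> real \<Rightarrow> complex) \<Rightarrow> bool" where
  "plane_drawing G p \<gamma> \<longleftrightarrow>
     inj_on p (verts G) \<and>
     (\<forall>e \<in> edges G. arc (\<gamma> e) \<and>
        {pathstart (\<gamma> e), pathfinish (\<gamma> e)} = p ` e \<and>
        path_image (\<gamma> e) \<inter> p ` verts G = p ` e) \<and>
     (\<forall>e \<in> edges G. \<forall>f \<in> edges G. e \<noteq> f \<longrightarrow>
        path_image (\<gamma> e) \<inter> path_image (\<gamma> f) = p ` (e \<inter> f))"

definition planar :: "'a graph \<Rightarrow> bool" where
  "planar G \<longleftrightarrow> (\<exists>p \<gamma>. plane_drawing G p \<gamma>)"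

definition induced_subgraph :: "'a graph \<Rightarrow> 'a set \<Rightarrow> 'a graph" where
  "induced_subgraph G W = (verts G \<inter> W, {e \<in> edges G. e \<subseteq> W})"

definition matching :: "'a graph \<Rightarrow> 'a set set \<Rightarrow> bool" where
  "matching G M \<longleftrightarrow> M \<subseteq> edges G \<and> disjoint M"

definition perfect_matching :: "'a graph \<Rightarrow> 'a set set \<Rightarrow> bool" where
  "perfect_matching G M \<longleftrightarrow> matching G M \<and> \<Union> M = verts G"

definition uniquely_restricted :: "'a graph \<Rightarrow> 'a set set \<Rightarrow> bool" where
  "uniquely_restricted G M \<longleftrightarrow>
     matching G M \<and>
     perfect_matching (induced_subgraph G (\<Union> M)) M \<and>
     (\<forall>N. perfect_matching (induced_subgraph G (\<Union> M)) N \<longrightarrow> N = M)"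

definition ur_edge_coloring :: "'a graph \<Rightarrow> ('a set \<Rightarrow> nat) \<Rightarrow> bool" where
  "ur_edge_coloring G c \<longleftrightarrow>
     (\<forall>k \<in> c ` edges G. uniquely_restricted G {e \<in> edges G. c e = k})"

definition ur_chromatic_index :: "'a graph \<Rightarrow> nat" where
  "ur_chromatic_index G = (LEAST n. \<exists>c. ur_edge_coloring G c \<and> card (c ` edges G) = n)"

text \<open>The minimum is over a nonempty set: giving all edges different colors is a uniquely
  restricted edge coloring.\<close>

lemma ur_edge_coloring_exists:
  assumes "simple_graph G"
  shows "\<exists>c. ur_edge_coloring G c"
proof -
  have fin: "finite (edges G)"
    using assms by (auto simp: simple_graph_def intro: finite_subset[of _ "Pow (verts G)"])
  then obtain c :: "'a set \<Rightarrow> nat" where c: "inj_on c (edges G)"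
    using finite_imp_inj_to_nat_seg by blast
  have "uniquely_restricted G {e}" if e: "e \<in> edges G" for e
  proof -
    have ev: "e \<subseteq> verts G" "card e = 2"
      using assms e by (auto simp: simple_graph_def)
    have "N = {e}" if N: "perfect_matching (induced_subgraph G e) N" for N
    proof -
      have *: "N \<subseteq> edges G" "\<And>f. f \<in> N \<Longrightarrow> f \<subseteq> e" "\<Union> N = e"
        using N ev by (auto simp: perfect_matching_def matching_def induced_subgraph_def)
      have "f = e" if "f \<in> N" for f
      proof -
        have "card f = 2" using that * assms by (auto simp: simple_graph_def)
        moreover have "finite e" using ev by (metis card.infinite zero_neq_numeral)
        ultimately show ?thesis using ev * that by (metis card_subset_eq)
      qed
      moreover have "N \<noteq> {}" using *(3) ev(2) by auto
      ultimately show ?thesis by auto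
    qed
    then show ?thesis
      using e ev by (auto simp: uniquely_restricted_def perfect_matching_def matching_def
          induced_subgraph_def)
  qed
  moreover have "{e \<in> edges G. c e = c f} = {f}" if "f \<in> edges G" for f
    using c that by (auto simp: inj_on_def)
  ultimately have "ur_edge_coloring G c"
    by (auto simp: ur_edge_coloring_def)
  then show ?thesis by blast
qed

end

theory Submission
  imports Defs
begin

text \<open>
  A planar graph whose cycles all have length at least \<open>6\<close> has a vertex of degree at most \<open>2\<close>, and
  so has each of its subgraphs with an edge: it is \<open>2\<close>-degenerate. Every \<open>k\<close>-degenerate graph
  satisfies \<open>\<chi>'\<^sub>u\<^sub>r \<le> k \<Delta>\<close>, and hence \<open>\<chi>'\<^sub>u\<^sub>r \<le> 2 \<Delta>\<close> in this case, which gives both bounds.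

  The coloring (\<open>ur_coloring_of_degenerate\<close>) is greedy. Remove a vertex \<open>v\<close> of degree at most \<open>k\<close>,
  color the rest, and give the edges at \<open>v\<close> distinct colors that do not occur at any neighbor of \<open>v\<close>
  in the rest; at most \<open>k (\<Delta> - 1)\<close> colors are excluded, so \<open>k\<close> others remain. If \<open>vu\<close> gets the color
  of \<open>M\<close>, then the only neighbor of \<open>v\<close> covered by \<open>M \<union> {vu}\<close> is \<open>u\<close>, so every matching that covers
  the same vertices contains \<open>vu\<close> and agrees with \<open>M\<close> on the rest.

  The degree bound follows from the edge bound \<open>(g - 2) m \<le> g (n - 1)\<close> for a nonempty plane graph
  with \<open>m\<close> edges, no isolated vertices among its \<open>n\<close> vertices, and all cycles of length at least \<open>g\<close>
  (\<open>plane_edge_bound\<close>). It is proved directly from the Jordan curve theorem, without a notion of face.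
  For a cycle of length \<open>k\<close> with the whole graph drawn on it or inside it, the sharper bound
  \<open>(g - 2) m \<le> g (n - 1) - k\<close> holds (\<open>plane_disc_edge_bound\<close>), which is what Euler's formula gives
  when each bounded face has at least \<open>g\<close> sides. Both bounds are proved in one induction on \<open>m\<close>:

  \<^item> a part of the graph that meets the remainder in at most one vertex can be split off;
  \<^item> if there is none, then the cycle has an ear, a path between two of its vertices with no edge and
    no inner vertex on it, which cuts the disc into two smaller discs (\<open>theta_split\<close>);
  \<^item> in a graph with a cycle, the edges inside and the edges outside it are treated separately,
    the outside being turned into an inside by an inversion of the plane.
\<close>


section \<open>Uniquely restricted colorings of degenerate graphs\<close>

text \<open>Unique restriction without the induced subgraph: edges of a matching that covers exactly \<open>\<Union> M\<close>
  lie in \<open>\<Union> M\<close> anyway.\<close>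

definition uniquely_coverable :: "'a set set \<Rightarrow> 'a set set \<Rightarrow> bool" where
  "uniquely_coverable E M \<longleftrightarrow> M \<subseteq> E \<and> disjoint M \<and>
     (\<forall>N. N \<subseteq> E \<longrightarrow> disjoint N \<longrightarrow> \<Union> N = \<Union> M \<longrightarrow> N = M)"

lemma uniquely_restricted_iff:
  assumes "\<And>e. e \<in> edges G \<Longrightarrow> e \<subseteq> verts G"
  shows "uniquely_restricted G M \<longleftrightarrow> uniquely_coverable (edges G) M"
proof (cases "M \<subseteq> edges G")
  case True
  then have "verts G \<inter> \<Union> M = \<Union> M" using assms by blast
  moreover have "N \<subseteq> {e \<in> edges G. e \<subseteq> \<Union> M} \<longleftrightarrow> N \<subseteq> edges G" if "\<Union> N = \<Union> M" for N
    using that by blast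
  ultimately have "perfect_matching (induced_subgraph G (\<Union> M)) N \<longleftrightarrow>
      N \<subseteq> edges G \<and> disjoint N \<and> \<Union> N = \<Union> M" for N
    unfolding perfect_matching_def matching_def induced_subgraph_def fst_conv snd_conv by metis
  then show ?thesis
    unfolding uniquely_restricted_def uniquely_coverable_def matching_def by metis
next
  case False
  then show ?thesis
    by (simp add: uniquely_restricted_def uniquely_coverable_def matching_def)
qed

lemma uniquely_coverable_avoiding:
  assumes "uniquely_coverable {e \<in> E. v \<notin> e} M"
  shows "uniquely_coverable E M"
  unfolding uniquely_coverable_def
proof (intro conjI allI impI)
  show "M \<subseteq> E" "disjoint M" using assms by (auto simp: uniquely_coverable_def)
  fix N assume N: "N \<subseteq> E" "disjoint N" "\<Union> N = \<Union> M"
  have "v \<notin> \<Union> M" using assms by (auto simp: uniquely_coverable_def)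
  then have "N \<subseteq> {e \<in> E. v \<notin> e}" using N by auto
  then show "N = M" using assms N by (simp add: uniquely_coverable_def)
qed

text \<open>The induction step of the greedy coloring: a class \<open>M\<close> of the graph without \<open>v\<close> may be extended
  by an edge at \<open>v\<close> if \<open>M\<close> covers no neighbor of \<open>v\<close>. A competing matching must then match \<open>v\<close>
  along that same edge.\<close>

lemma uniquely_coverable_insert:
  assumes M: "uniquely_coverable {e \<in> E. v \<notin> e} M"
    and e: "e \<in> E" "v \<in> e"
    and free: "\<And>f. f \<in> E \<Longrightarrow> v \<in> f \<Longrightarrow> f \<inter> \<Union> M = {}"
    and card2: "\<And>f. f \<in> E \<Longrightarrow> card f = 2"
  shows "uniquely_coverable E (insert e M)"
  unfolding uniquely_coverable_def
proof (intro conjI allI impI)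
  show "insert e M \<subseteq> E" using M e by (auto simp: uniquely_coverable_def)
  have "e \<inter> \<Union> M = {}" using free e by blast
  then show "disjoint (insert e M)"
    using M by (auto simp: uniquely_coverable_def disjoint_def)
  fix N assume N: "N \<subseteq> E" "disjoint N" "\<Union> N = \<Union> (insert e M)"
  obtain f where f: "f \<in> N" "v \<in> f" using N(3) e by blast
  \<comment> \<open>The other end of \<open>f\<close> is covered by \<open>e\<close>, as it cannot be covered by \<open>M\<close>.\<close>
  have "f \<subseteq> e" using free[of f] f N by blast
  moreover have "finite e" "card e = card f"
    using card2 e f N by (auto intro: card_ge_0_finite)
  ultimately have "f = e" by (simp add: card_subset_eq)
  have "g \<inter> e = {}" if "g \<in> N - {e}" for g
    using that N(2) f \<open>f = e\<close> by (auto simp: disjoint_def)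
  then have "\<Union> (N - {e}) = \<Union> N - e" by blast
  also have "\<dots> = \<Union> M" using N(3) \<open>e \<inter> \<Union> M = {}\<close> by blast
  finally have *: "\<Union> (N - {e}) = \<Union> M" .
  have "v \<notin> \<Union> M" using M by (auto simp: uniquely_coverable_def)
  have "g \<in> E \<and> v \<notin> g" if "g \<in> N - {e}" for g
  proof -
    have "g \<subseteq> \<Union> M" using that * by (metis Union_upper)
    then have "v \<notin> g" using \<open>v \<notin> \<Union> M\<close> by (rule contra_subsetD)
    then show ?thesis using that N(1) by auto
  qed
  then have "N - {e} \<subseteq> {e \<in> E. v \<notin> e}" by (intro subsetI CollectI)
  moreover have "disjoint (N - {e})" using N(2) by (auto simp: disjoint_def)
  ultimately have "N - {e} = M" using M * by (simp add: uniquely_coverable_def)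
  then show "N = insert e M" using f \<open>f = e\<close> by blast
qed

text \<open>Degeneracy is stated for edge sets: every nonempty one has a vertex of degree at most \<open>k\<close> among
  the vertices that it covers.\<close>

lemma ur_coloring_of_degenerate:
  assumes "finite E" and card2: "\<And>e. e \<in> E \<Longrightarrow> card e = 2"
    and deg: "\<And>v. card {e \<in> E. v \<in> e} \<le> D"
    and degen: "\<And>F. F \<subseteq> E \<Longrightarrow> F \<noteq> {} \<Longrightarrow> \<exists>v \<in> \<Union> F. card {e \<in> F. v \<in> e} \<le> k"
  shows "\<exists>c. c ` E \<subseteq> {..<k * D} \<and> (\<forall>i. uniquely_coverable E {e \<in> E. c e = i})"
  using assms
proof (induction "card E" arbitrary: E rule: less_induct)
  case less
  show ?case
  proof (cases "E = {}")
    case True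
    then show ?thesis by (auto simp: uniquely_coverable_def)
  next
    case False
    then obtain v where v: "v \<in> \<Union> E" "card {e \<in> E. v \<in> e} \<le> k"
      using less.prems(4)[of E] by blast
    define F where "F = {e \<in> E. v \<in> e}"
    define E' where "E' = {e \<in> E. v \<notin> e}"
    have "E' \<subset> E" "finite F" "F \<noteq> {}" using v less.prems(1) by (auto simp: E'_def F_def)
    then have "card E' < card E" "finite E'"
      using less.prems(1) by (auto intro: psubset_card_mono finite_subset)
    moreover have "card {e \<in> E'. w \<in> e} \<le> D" for w
    proof -
      have "card {e \<in> E'. w \<in> e} \<le> card {e \<in> E. w \<in> e}"
        using less.prems(1) by (intro card_mono) (auto simp: E'_def)
      then show ?thesis using less.prems(3)[of w] by simp
    qed
    ultimately have "\<exists>c. c ` E' \<subseteq> {..<k * D} \<and> (\<forall>i. uniquely_coverable E' {e \<in> E'. c e = i})"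
      using less.prems(2,4) \<open>E' \<subset> E\<close> by (intro less.hyps) auto
    then obtain c where c: "c ` E' \<subseteq> {..<k * D}"
        "\<And>i. uniquely_coverable E' {e \<in> E'. c e = i}"
      by blast
    define B where "B = (\<Union>e \<in> F. c ` {f \<in> E'. f \<inter> e \<noteq> {}})"
    \<comment> \<open>The edge from \<open>v\<close> uses up one of the at most \<open>D\<close> places at its other end.\<close>
    have "card (c ` {f \<in> E'. f \<inter> e \<noteq> {}}) \<le> D - 1" if e: "e \<in> F" for e
    proof -
      have "card e = 2" "v \<in> e" "e \<in> E" using e less.prems(2) by (auto simp: F_def)
      then obtain w where w: "e = {v, w}" by (metis card_2_iff doubleton_eq_iff insertE singletonD)
      have "card (c ` {f \<in> E'. f \<inter> e \<noteq> {}}) \<le> card {f \<in> E'. f \<inter> e \<noteq> {}}"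
        using \<open>finite E'\<close> by (intro card_image_le) simp
      also have "\<dots> \<le> card ({f \<in> E. w \<in> f} - {e})"
        using less.prems(1) w by (intro card_mono) (auto simp: E'_def)
      also have "\<dots> = card {f \<in> E. w \<in> f} - 1"
        using less.prems(1) w \<open>e \<in> E\<close> by (intro card_Diff_singleton) simp
      also have "\<dots> \<le> D - 1" using less.prems(3)[of w] by simp
      finally show ?thesis .
    qed
    then have "card B \<le> card F * (D - 1)"
      unfolding B_def using \<open>finite F\<close>
      by (intro order.trans[OF card_UN_le] order.trans[OF sum_bounded_above[where K = "D - 1"]])
        simp_all
    moreover have "0 < D"
      using less.prems(3)[of v] \<open>F \<noteq> {}\<close> \<open>finite F\<close> by (metis F_def card_gt_0_iff less_le_trans)
    moreover have "card F \<le> k" using v by (simp add: F_def)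
    then have "card F * (D - 1) \<le> k * (D - 1)" by simp
    moreover have "k * (D - 1) + k = k * D" using \<open>0 < D\<close> by (cases D) auto
    moreover have "finite B" using \<open>finite F\<close> \<open>finite E'\<close> by (simp add: B_def)
    ultimately have "card F \<le> card ({..<k * D} - B)"
      using \<open>card F \<le> k\<close> diff_card_le_card_Diff[of B "{..<k * D}"] unfolding card_lessThan
      by linarith
    then obtain h where h: "h ` F \<subseteq> {..<k * D} - B" "inj_on h F"
      using card_le_inj[of F "{..<k * D} - B"] \<open>finite F\<close> by auto
    define c' where "c' = (\<lambda>e. if v \<in> e then h e else c e)"
    have "uniquely_coverable E {e \<in> E. c' e = i}" for i
    proof (cases "i \<in> h ` F")
      case True
      then obtain e where e: "e \<in> F" "i = h e" by auto
      have "{f \<in> E. c' f = i} = {f \<in> F. h f = i} \<union> {f \<in> E'. c f = i}"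
        by (auto simp: c'_def F_def E'_def)
      moreover have "{f \<in> F. h f = i} = {e}" using e h(2) by (auto dest: inj_onD)
      ultimately have eq: "{f \<in> E. c' f = i} = insert e {f \<in> E'. c f = i}" by simp
      show ?thesis unfolding eq
      proof (rule uniquely_coverable_insert)
        show "uniquely_coverable {e \<in> E. v \<notin> e} {f \<in> E'. c f = i}"
          using c(2)[of i] by (simp add: E'_def)
        show "f \<inter> \<Union> {f \<in> E'. c f = i} = {}" if "f \<in> E" "v \<in> f" for f
        proof -
          have "i \<notin> B" "f \<in> F" using e h(1) that by (auto simp: F_def)
          then show ?thesis unfolding B_def by blast
        qed
        show "e \<in> E" "v \<in> e" using e by (auto simp: F_def)
        show "card f = 2" if "f \<in> E" for f using that less.prems(2) by simp
      qed
    next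
      case False
      then have eq: "{f \<in> E. c' f = i} = {f \<in> E'. c f = i}"
        by (auto simp: c'_def F_def E'_def)
      show ?thesis unfolding eq using c(2)[of i] uniquely_coverable_avoiding[of E v]
        by (simp add: E'_def)
    qed
    moreover have "c' ` E \<subseteq> {..<k * D}"
      using c(1) h(1) by (auto simp: c'_def E'_def F_def)
    ultimately show ?thesis by blast
  qed
qed

lemma ur_chromatic_index_le:
  assumes G: "simple_graph G"
    and degen: "\<And>F. F \<subseteq> edges G \<Longrightarrow> F \<noteq> {} \<Longrightarrow> \<exists>v \<in> \<Union> F. card {e \<in> F. v \<in> e} \<le> k"
  shows "ur_chromatic_index G \<le> k * max_degree G"
proof -
  have E: "e \<subseteq> verts G" "card e = 2" if "e \<in> edges G" for e
    using G that by (auto simp: simple_graph_def)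
  have fin: "finite (verts G)" "finite (edges G)"
    using G by (auto simp: simple_graph_def intro: finite_subset[of _ "Pow (verts G)"])
  have "card {e \<in> edges G. v \<in> e} \<le> max_degree G" for v
  proof (cases "v \<in> verts G")
    case True
    then show ?thesis unfolding max_degree_def using fin
      by (intro Max_ge) (auto simp: degree_def)
  next
    case False
    then have none: "{e \<in> edges G. v \<in> e} = {}" using E by auto
    show ?thesis unfolding none by simp
  qed
  then obtain c where c: "c ` edges G \<subseteq> {..<k * max_degree G}"
      "\<And>i. uniquely_coverable (edges G) {e \<in> edges G. c e = i}"
    using ur_coloring_of_degenerate[of "edges G" "max_degree G" k, OF fin(2) E(2) _ degen] by blast
  then have "ur_edge_coloring G c"
    unfolding ur_edge_coloring_def using uniquely_restricted_iff[OF E(1)] by blast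
  then have "ur_chromatic_index G \<le> card (c ` edges G)"
    unfolding ur_chromatic_index_def by (intro Least_le) blast
  also have "\<dots> \<le> k * max_degree G"
    using card_mono[OF _ c(1)] by simp
  finally show ?thesis .
qed


section \<open>Paths, cycles and ears in edge sets\<close>

text \<open>From here on, a graph is given by its edge set \<open>E\<close>, with vertex set \<open>\<Union> E\<close>, so that parts of a graph
  are just subsets. Paths are lists of vertices, and cycles are lists that are closed up by repeating
  the first vertex.\<close>

fun path_edges :: "'a list \<Rightarrow> 'a set set" where
  "path_edges (x # y # xs) = insert {x, y} (path_edges (y # xs))"
| "path_edges _ = {}"

definition cycle_edges :: "'a list \<Rightarrow> 'a set set" where
  "cycle_edges xs = path_edges (xs @ [hd xs])"

definition cycle_in :: "'a set set \<Rightarrow> 'a list \<Rightarrow> bool" where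
  "cycle_in E xs \<longleftrightarrow> 3 \<le> length xs \<and> distinct xs \<and> cycle_edges xs \<subseteq> E"

lemma path_edges_append:
  "path_edges (xs @ y # ys) = path_edges (xs @ [y]) \<union> path_edges (y # ys)"
  by (induction xs rule: path_edges.induct) auto

lemma path_edges_Cons: "xs \<noteq> [] \<Longrightarrow> path_edges (x # xs) = insert {x, hd xs} (path_edges xs)"
  by (cases xs) auto

lemma path_edges_snoc:
  assumes "xs \<noteq> []"
  shows "path_edges (xs @ [y]) = insert {last xs, y} (path_edges xs)"
proof -
  obtain ys x where "xs = ys @ [x]" using assms by (metis rev_exhaust)
  then show ?thesis using path_edges_append[of ys x "[y]"] by simp
qed

lemma path_edges_rev: "path_edges (rev xs) = path_edges xs"
proof (induction xs rule: path_edges.induct)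
  case (1 x y xs)
  then show ?case using path_edges_append[of "rev xs" y "[x]"] by (simp add: insert_commute)
qed auto

lemma finite_path_edges [simp]: "finite (path_edges xs)"
  by (induction xs rule: path_edges.induct) auto

lemma path_edges_subset: "e \<in> path_edges xs \<Longrightarrow> e \<subseteq> set xs"
  by (induction xs rule: path_edges.induct) auto

lemma Union_path_edges: "2 \<le> length xs \<Longrightarrow> \<Union> (path_edges xs) = set xs"
proof (induction xs rule: path_edges.induct)
  case (1 x y xs)
  then show ?case by (cases xs) auto
qed auto

lemma card_path_edges: "distinct xs \<Longrightarrow> card (path_edges xs) = length xs - 1"
proof (induction xs rule: path_edges.induct)
  case (1 x y xs)
  then have "{x, y} \<notin> path_edges (y # xs)" using path_edges_subset by fastforce
  then show ?case using 1 by simp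
qed auto

lemma path_edges_nth: "Suc i < length xs \<Longrightarrow> {xs ! i, xs ! Suc i} \<in> path_edges xs"
proof (induction xs arbitrary: i rule: path_edges.induct)
  case (1 x y xs)
  then show ?case by (cases i) auto
qed auto

lemma cycle_edges_Cons: "cycle_edges (x # xs) = path_edges (x # xs @ [x])"
  by (simp add: cycle_edges_def)

lemma Union_cycle_edges: "2 \<le> length xs \<Longrightarrow> \<Union> (cycle_edges xs) = set xs"
  unfolding cycle_edges_def by (subst Union_path_edges) (cases xs; auto)+

lemma card_cycle_edges:
  assumes "distinct xs" "3 \<le> length xs"
  shows "card (cycle_edges xs) = length xs"
proof -
  obtain x y zs where xs: "xs = x # y # zs" "zs \<noteq> []"
    using assms(2) by (auto simp: numeral_3_eq_3 Suc_le_length_iff)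
  have "{last zs, x} \<notin> path_edges (y # zs)"
    using path_edges_subset[of "{last zs, x}" "y # zs"] assms(1) xs by auto
  moreover have "last zs \<noteq> y" using assms(1) xs by auto
  then have "{last zs, x} \<noteq> {x, y}" using assms(1) xs by (auto simp: doubleton_eq_iff)
  ultimately have "{last zs, x} \<notin> path_edges xs" using xs by simp
  moreover have "cycle_edges xs = insert {last zs, x} (path_edges xs)"
    using path_edges_snoc[of xs x] xs by (simp add: cycle_edges_def)
  ultimately show ?thesis using card_path_edges[OF assms(1)] assms(2) by simp
qed

lemma is_cycle_if_cycle_in:
  assumes "cycle_in (edges G) xs"
  shows "is_cycle G xs"
  unfolding is_cycle_def
proof (intro conjI allI impI)
  fix i assume i: "i < length xs"
  have "(xs @ [hd xs]) ! Suc i = xs ! (Suc i mod length xs)"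
    using i hd_conv_nth[of xs] by (cases "xs = []"; cases "Suc i = length xs") (auto simp: nth_append)
  then show "{xs ! i, xs ! (Suc i mod length xs)} \<in> edges G"
    using path_edges_nth[of i "xs @ [hd xs]"] i assms
    by (auto simp: cycle_in_def cycle_edges_def nth_append)
qed (use assms in \<open>auto simp: cycle_in_def\<close>)

lemma cycle_edges_rotate: "cycle_edges (xs @ ys) = cycle_edges (ys @ xs)"
proof (cases "xs = [] \<or> ys = []")
  case False
  then obtain x xs' y ys' where "xs = x # xs'" "ys = y # ys'" by (meson neq_Nil_conv)
  then show ?thesis
    using path_edges_append[of "x # xs'" y "ys' @ [x]"] path_edges_append[of "y # ys'" x "xs' @ [y]"]
    by (simp add: cycle_edges_def Un_commute)
qed auto

text \<open>Rotating a cycle exhibits it as two paths between any two of its vertices.\<close>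

lemma cycle_through_two_vertices:
  assumes "distinct xs" "a \<in> set xs" "b \<in> set xs" "a \<noteq> b"
  obtains ys zs where "distinct (a # ys @ b # zs)" "set (a # ys @ b # zs) = set xs"
    "length (a # ys @ b # zs) = length xs" "cycle_edges (a # ys @ b # zs) = cycle_edges xs"
proof -
  obtain us vs where xs: "xs = us @ a # vs" using assms(2) by (meson split_list)
  then have "b \<in> set (vs @ us)" using assms(3,4) by auto
  then obtain ys zs where "vs @ us = ys @ b # zs" by (meson split_list)
  then have *: "a # ys @ b # zs = (a # vs) @ us" by simp
  show ?thesis
  proof
    show "distinct (a # ys @ b # zs)" unfolding * using xs assms(1) by auto
    show "set (a # ys @ b # zs) = set xs" unfolding * using xs by auto
    show "length (a # ys @ b # zs) = length xs" unfolding * using xs by simp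
    show "cycle_edges (a # ys @ b # zs) = cycle_edges xs"
      unfolding * xs by (rule cycle_edges_rotate)
  qed
qed

text \<open>If no edge outside \<open>C\<close> has a vertex on \<open>C\<close>, then \<open>E - C\<close> can be split off. Otherwise start from
  such an edge \<open>ax\<close> with \<open>a\<close> on \<open>C\<close>, and take all edges outside \<open>C\<close> that touch a vertex reachable
  from \<open>x\<close> off \<open>C\<close>. If these reach \<open>C\<close> in a vertex other than \<open>a\<close>, there is an ear; otherwise
  they meet the remaining edges in \<open>a\<close> at most. The lemma serves for a cycle \<open>C\<close>, and also for a
  single edge \<open>C\<close>, where an ear closes up to a cycle.\<close>

lemma ear_or_split:
  assumes "C \<subseteq> E" "C \<noteq> E" and card2: "\<And>e. e \<in> E \<Longrightarrow> card e = 2"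
  obtains (ear) P where "2 \<le> length P" "distinct P" "path_edges P \<subseteq> E - C"
      "set P \<inter> \<Union> C = {hd P, last P}"
  | (split) K a where "K \<subseteq> E - C" "K \<noteq> {}" "\<Union> K \<inter> \<Union> (E - K) \<subseteq> {a}"
proof (cases "\<Union> (E - C) \<inter> \<Union> C = {}")
  case True
  moreover have "E - (E - C) = C" using assms(1) by auto
  ultimately show thesis using split[of "E - C"] assms(1,2) by auto
next
  case False
  then obtain a e0 where a: "a \<in> \<Union> C" "e0 \<in> E - C" "a \<in> e0" by blast
  have pair: "\<exists>z. e = {y, z} \<and> z \<noteq> y" if "e \<in> E" "y \<in> e" for e y
    using card2[OF that(1)] that(2) unfolding card_2_iff by fastforce
  obtain x where x: "e0 = {a, x}" "x \<noteq> a" using pair a by blast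
  show thesis
  proof (cases "x \<in> \<Union> C")
    case True
    then show thesis using a x by (intro ear[of "[a, x]"]) auto
  next
    case xC: False
    define reach where "reach y xs \<longleftrightarrow> xs \<noteq> [] \<and> distinct xs \<and> hd xs = x \<and> last xs = y \<and>
      path_edges xs \<subseteq> E - C \<and> set xs \<inter> \<Union> C = {}" for y xs
    define R where "R = {y. \<exists>xs. reach y xs}"
    define K where "K = {e \<in> E - C. e \<inter> R \<noteq> {}}"
    have R: "\<exists>xs. reach y xs" if "y \<in> R" for y using that by (simp add: R_def)
    have RI: "y \<in> R" if "reach y xs" for y xs using that by (auto simp: R_def)
    have "reach x [x]" using xC by (simp add: reach_def)
    then have "x \<in> R" by (rule RI)
    have RC: "y \<notin> \<Union> C" if y: "y \<in> R" for y
    proof -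
      obtain xs where "reach y xs" using R[OF y] by blast
      then have "y \<in> set xs" "set xs \<inter> \<Union> C = {}" unfolding reach_def using last_in_set by auto
      then show ?thesis by (meson disjoint_iff)
    qed
    have step: "z \<in> R" if y: "y \<in> R" and z: "{y, z} \<in> E - C" "z \<notin> \<Union> C" for y z
    proof -
      obtain xs where xs: "xs \<noteq> []" "distinct xs" "hd xs = x" "last xs = y"
        "path_edges xs \<subseteq> E - C" "set xs \<inter> \<Union> C = {}"
        using R y unfolding reach_def by meson
      show ?thesis
      proof (cases "z \<in> set xs")
        case True
        \<comment> \<open>The walk closes up; its initial part is a path to \<open>z\<close>.\<close>
        then obtain us vs where us: "xs = us @ z # vs" by (meson split_list)
        have "path_edges (us @ [z]) \<subseteq> path_edges xs"
          unfolding us path_edges_append[of us z vs] by (rule Un_upper1)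
        then have "path_edges (us @ [z]) \<subseteq> E - C" using xs(5) by (rule order.trans)
        moreover have "hd (us @ [z]) = x" using us xs(3) by (cases us) auto
        moreover have "set (us @ [z]) \<subseteq> set xs" using us by auto
        then have "set (us @ [z]) \<inter> \<Union> C = {}" using xs(6) by (meson disjoint_iff subsetD)
        moreover have "distinct (us @ [z])" using us xs(2) by simp
        ultimately have "reach z (us @ [z])" unfolding reach_def by simp
        then show ?thesis by (rule RI)
      next
        case False
        have "set (xs @ [z]) \<inter> \<Union> C = {}" using xs(6) z(2) by simp
        then have "reach z (xs @ [z])"
          using xs z(1) False by (simp add: reach_def path_edges_snoc)
        then show ?thesis by (rule RI)
      qed
    qed
    show thesis
    proof (cases "\<exists>b. b \<in> \<Union> K \<inter> \<Union> C \<and> b \<noteq> a")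
      case True
      then obtain b e where b: "e \<in> K" "b \<in> e" "b \<in> \<Union> C" "b \<noteq> a" by blast
      then obtain y where y: "y \<in> e" "y \<in> R" unfolding K_def by blast
      then have "y \<noteq> b" using RC b by blast
      then have e: "e = {y, b}" using pair[of e b] b y unfolding K_def by auto
      obtain xs where xs: "xs \<noteq> []" "distinct xs" "hd xs = x" "last xs = y"
        "path_edges xs \<subseteq> E - C" "set xs \<inter> \<Union> C = {}"
        using R y unfolding reach_def by meson
      show thesis
      proof (rule ear[of "a # xs @ [b]"])
        show "distinct (a # xs @ [b])" using xs a b by auto
        have "path_edges (a # xs @ [b]) = insert {a, x} (insert {y, b} (path_edges xs))"
          using xs by (simp add: path_edges_Cons path_edges_snoc)
        then show "path_edges (a # xs @ [b]) \<subseteq> E - C"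
          using xs a x b e unfolding K_def by auto
        show "set (a # xs @ [b]) \<inter> \<Union> C = {hd (a # xs @ [b]), last (a # xs @ [b])}"
          using xs(6) a b by auto
      qed simp
    next
      case False
      show thesis
      proof (rule split[of K a])
        show "K \<subseteq> E - C" unfolding K_def by blast
        show "K \<noteq> {}" unfolding K_def using a x \<open>x \<in> R\<close> by blast
        show "\<Union> K \<inter> \<Union> (E - K) \<subseteq> {a}"
        proof
          fix v assume "v \<in> \<Union> K \<inter> \<Union> (E - K)"
          then obtain e f where v: "e \<in> K" "v \<in> e" "f \<in> E - K" "v \<in> f" by blast
          show "v \<in> {a}"
          proof (cases "v \<in> \<Union> C")
            case True
            then show ?thesis using False v by blast
          next
            case vC: False
            obtain y where y: "y \<in> e" "y \<in> R" "e \<in> E - C" using v unfolding K_def by blast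
            have "v \<in> R"
            proof (cases "v = y")
              case False
              then have "e = {y, v}" using pair[of e y] y v by auto
              then show ?thesis using step y vC by blast
            qed (use y in simp)
            moreover have "f \<notin> C" using vC v by blast
            ultimately have "f \<in> K" using v unfolding K_def by blast
            then show ?thesis using v by blast
          qed
        qed
      qed
    qed
  qed
qed

lemma handshake:
  assumes "finite E" "\<And>e. e \<in> E \<Longrightarrow> card e = 2"
  shows "(\<Sum>v \<in> \<Union> E. card {e \<in> E. v \<in> e}) = 2 * card E"
proof -
  have "finite (\<Union> E)" using assms by (metis card.infinite finite_Union zero_neq_numeral)
  moreover have "{v \<in> \<Union> E. v \<in> e} = e" if "e \<in> E" for e using that by blast
  ultimately have "(\<Sum>v \<in> \<Union> E. card {e \<in> E. v \<in> e}) = (\<Sum>e \<in> E. 2)"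
    using assms by (intro sum_multicount_gen) auto
  then show ?thesis by simp
qed


section \<open>Drawings of edge sets\<close>

definition plane_edges :: "'a set set \<Rightarrow> ('a \<Rightarrow> complex) \<Rightarrow> ('a set \<Rightarrow> real \<Rightarrow> complex) \<Rightarrow> bool" where
  "plane_edges E p \<gamma> \<longleftrightarrow>
     finite E \<and> (\<forall>e \<in> E. card e = 2) \<and> plane_drawing (\<Union> E, E) p \<gamma>"

definition drawn :: "('a set \<Rightarrow> real \<Rightarrow> complex) \<Rightarrow> 'a set set \<Rightarrow> complex set" where
  "drawn \<gamma> X = (\<Union>e \<in> X. path_image (\<gamma> e))"

lemma drawn_Un: "drawn \<gamma> (X \<union> Y) = drawn \<gamma> X \<union> drawn \<gamma> Y"
  by (auto simp: drawn_def)

lemma path_image_subset_drawn: "e \<in> X \<Longrightarrow> path_image (\<gamma> e) \<subseteq> drawn \<gamma> X"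
  by (auto simp: drawn_def)

context
  fixes E :: "'a set set" and p :: "'a \<Rightarrow> complex" and \<gamma> :: "'a set \<Rightarrow> real \<Rightarrow> complex"
  assumes plane: "plane_edges E p \<gamma>"
begin

lemma plane_finite: "finite E" "finite (\<Union> E)"
proof -
  show "finite E" using plane by (simp add: plane_edges_def)
  then show "finite (\<Union> E)"
    using plane by (metis card.infinite finite_Union plane_edges_def zero_neq_numeral)
qed

lemma plane_card: "e \<in> E \<Longrightarrow> card e = 2"
  using plane by (auto simp: plane_edges_def)

lemma plane_inj: "inj_on p (\<Union> E)"
  using plane by (simp add: plane_edges_def plane_drawing_def)

lemma plane_arc:
  assumes "e \<in> E"
  shows "arc (\<gamma> e)" "{pathstart (\<gamma> e), pathfinish (\<gamma> e)} = p ` e"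
    "path_image (\<gamma> e) \<inter> p ` \<Union> E = p ` e"
  using plane assms by (simp_all add: plane_edges_def plane_drawing_def)

lemma plane_crossing:
  "e \<in> E \<Longrightarrow> f \<in> E \<Longrightarrow> e \<noteq> f \<Longrightarrow> path_image (\<gamma> e) \<inter> path_image (\<gamma> f) = p ` (e \<inter> f)"
  using plane by (simp add: plane_edges_def plane_drawing_def)

lemma plane_edges_subset:
  assumes "F \<subseteq> E"
  shows "plane_edges F p \<gamma>"
proof -
  have U: "\<Union> F \<subseteq> \<Union> E" using assms by blast
  have "path_image (\<gamma> e) \<inter> p ` \<Union> F = p ` e" if e: "e \<in> F" for e
  proof
    have "e \<in> E" using e assms by blast
    show "path_image (\<gamma> e) \<inter> p ` \<Union> F \<subseteq> p ` e"
      using plane_arc(3)[OF \<open>e \<in> E\<close>] U by blast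
    have "e \<subseteq> \<Union> F" using e by blast
    then show "p ` e \<subseteq> path_image (\<gamma> e) \<inter> p ` \<Union> F"
      using plane_arc(3)[OF \<open>e \<in> E\<close>] by blast
  qed
  moreover have "finite F" using plane_finite assms finite_subset by blast
  moreover have "inj_on p (\<Union> F)" by (rule inj_on_subset[OF plane_inj U])
  ultimately show ?thesis
    unfolding plane_edges_def plane_drawing_def fst_conv snd_conv
    using plane_arc(1,2) plane_card plane_crossing subsetD[OF assms]
    by (intro conjI ballI impI) simp_all
qed

lemma vertex_in_path_image: "e \<in> E \<Longrightarrow> v \<in> e \<Longrightarrow> p v \<in> path_image (\<gamma> e)"
  using plane_arc(3)[of e] by blast

lemma vertex_in_drawn:
  assumes "X \<subseteq> E" "v \<in> \<Union> X"
  shows "p v \<in> drawn \<gamma> X"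
  using assms vertex_in_path_image unfolding drawn_def by blast

lemma vertex_in_drawn_iff:
  assumes "X \<subseteq> E" "v \<in> \<Union> E"
  shows "p v \<in> drawn \<gamma> X \<longleftrightarrow> v \<in> \<Union> X"
proof
  assume "p v \<in> drawn \<gamma> X"
  then obtain e where e: "e \<in> X" "p v \<in> path_image (\<gamma> e)" by (auto simp: drawn_def)
  then have "p v \<in> p ` e" using plane_arc(3)[of e] assms by blast
  moreover have "e \<subseteq> \<Union> E" using e assms by blast
  ultimately have "v \<in> e" by (simp add: inj_on_image_mem_iff[OF plane_inj assms(2)])
  then show "v \<in> \<Union> X" using e by blast
qed (use assms vertex_in_drawn in blast)

lemma drawn_Int:
  assumes "X \<subseteq> E" "Y \<subseteq> E" "X \<inter> Y = {}"
  shows "drawn \<gamma> X \<inter> drawn \<gamma> Y = p ` (\<Union> X \<inter> \<Union> Y)"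
proof
  show "drawn \<gamma> X \<inter> drawn \<gamma> Y \<subseteq> p ` (\<Union> X \<inter> \<Union> Y)"
  proof
    fix z assume "z \<in> drawn \<gamma> X \<inter> drawn \<gamma> Y"
    then obtain e f where ef: "e \<in> X" "z \<in> path_image (\<gamma> e)" "f \<in> Y" "z \<in> path_image (\<gamma> f)"
      by (auto simp: drawn_def)
    then have "z \<in> p ` (e \<inter> f)" using plane_crossing[of e f] assms by blast
    then show "z \<in> p ` (\<Union> X \<inter> \<Union> Y)" using ef by blast
  qed
  show "p ` (\<Union> X \<inter> \<Union> Y) \<subseteq> drawn \<gamma> X \<inter> drawn \<gamma> Y" using vertex_in_drawn assms by blast
qed

lemma path_image_Int_drawn:
  assumes "X \<subseteq> E" "e \<in> E" "e \<notin> X"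
  shows "path_image (\<gamma> e) \<inter> drawn \<gamma> X \<subseteq> {pathstart (\<gamma> e), pathfinish (\<gamma> e)}"
  using drawn_Int[of "{e}" X] assms plane_arc(2)[of e] by (auto simp: drawn_def)

text \<open>Edges meet the drawing of other edges in end points only, and an arc is more than its end points.
  With this, equality of edge sets can be read off from point sets of the plane.\<close>

lemma edge_in_if_drawn:
  assumes "X \<subseteq> E" "e \<in> E" "path_image (\<gamma> e) \<subseteq> drawn \<gamma> X"
  shows "e \<in> X"
proof (rule ccontr)
  assume "e \<notin> X"
  then have "path_image (\<gamma> e) \<subseteq> {pathstart (\<gamma> e), pathfinish (\<gamma> e)}"
    using path_image_Int_drawn assms by blast
  then show False
    using nonempty_simple_path_endless[OF arc_imp_simple_path] plane_arc(1) assms(2) by blast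
qed

lemma compact_drawn: "X \<subseteq> E \<Longrightarrow> compact (drawn \<gamma> X)"
  unfolding drawn_def using plane_finite(1) plane_arc(1)
  by (intro compact_UN) (auto intro: finite_subset compact_arc_image)

lemma edge_arc_from_to:
  assumes "{x, y} \<in> E"
  obtains g where "arc g" "pathstart g = p x" "pathfinish g = p y"
    "path_image g = path_image (\<gamma> {x, y})"
proof (cases "pathstart (\<gamma> {x, y}) = p x")
  case True
  then have "pathfinish (\<gamma> {x, y}) = p y"
    using plane_arc(2)[OF assms] by (auto simp: doubleton_eq_iff)
  then show thesis using True plane_arc(1)[OF assms] that by blast
next
  case False
  then have "pathstart (\<gamma> {x, y}) = p y" "pathfinish (\<gamma> {x, y}) = p x"
    using plane_arc(2)[OF assms] by (auto simp: doubleton_eq_iff)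
  then show thesis
    using plane_arc(1)[OF assms] that[of "reversepath (\<gamma> {x, y})"] by (simp add: arc_reversepath)
qed

lemma path_arc:
  assumes "distinct xs" "2 \<le> length xs" "path_edges xs \<subseteq> E"
  obtains g where "arc g" "pathstart g = p (hd xs)" "pathfinish g = p (last xs)"
    "path_image g = drawn \<gamma> (path_edges xs)"
proof -
  have "\<exists>g. arc g \<and> pathstart g = p (hd xs) \<and> pathfinish g = p (last xs) \<and>
    path_image g = drawn \<gamma> (path_edges xs)"
    using assms
  proof (induction xs rule: path_edges.induct)
    case (1 x y xs)
    then have xy: "{x, y} \<in> E" by simp
    then obtain h where h: "arc h" "pathstart h = p x" "pathfinish h = p y"
      "path_image h = path_image (\<gamma> {x, y})" by (rule edge_arc_from_to)
    show ?case
    proof (cases "xs = []")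
      case True
      then show ?thesis using h by (auto simp: drawn_def)
    next
      case False
      then have "2 \<le> length (y # xs)" by (simp add: Suc_le_eq)
      then obtain g where g: "arc g" "pathstart g = p y" "pathfinish g = p (last xs)"
        "path_image g = drawn \<gamma> (path_edges (y # xs))"
        using 1 False by auto
      have "{x, y} \<notin> path_edges (y # xs)"
        using path_edges_subset[of "{x, y}" "y # xs"] 1(2) by auto
      then have "path_image h \<inter> path_image g = p ` ({x, y} \<inter> set (y # xs))"
        using drawn_Int[of "{{x, y}}" "path_edges (y # xs)"] 1(4) xy
          Union_path_edges[OF \<open>2 \<le> length (y # xs)\<close>]
        by (simp add: h(4) g(4) drawn_def)
      also have "{x, y} \<inter> set (y # xs) = {y}" using 1(2) by auto
      finally have "arc (h +++ g)" using h g by (intro arc_join) auto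
      moreover have "path_image (h +++ g) = drawn \<gamma> (path_edges (x # y # xs))"
        using h g by (simp add: path_image_join drawn_def)
      ultimately show ?thesis using h g False by (intro exI[of _ "h +++ g"]) auto
    qed
  qed auto
  then show thesis using that by blast
qed

lemma cycle_closed_curve:
  assumes "cycle_in E xs"
  obtains c where "simple_path c" "pathfinish c = pathstart c"
    "path_image c = drawn \<gamma> (cycle_edges xs)"
proof -
  have xs: "distinct xs" "3 \<le> length xs" "cycle_edges xs \<subseteq> E" "xs \<noteq> []"
    using assms by (auto simp: cycle_in_def)
  let ?e = "{last xs, hd xs}"
  have ce: "cycle_edges xs = insert ?e (path_edges xs)"
    using path_edges_snoc[OF xs(4)] by (simp add: cycle_edges_def)
  have "card (cycle_edges xs) = length xs" using xs by (intro card_cycle_edges)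
  then have e: "?e \<notin> path_edges xs"
    using card_path_edges[OF xs(1)] xs(2) ce by (auto simp: insert_absorb)
  obtain g where g: "arc g" "pathstart g = p (hd xs)" "pathfinish g = p (last xs)"
    "path_image g = drawn \<gamma> (path_edges xs)"
    using path_arc[of xs] xs ce by auto
  obtain h where h: "arc h" "pathstart h = p (last xs)" "pathfinish h = p (hd xs)"
    "path_image h = path_image (\<gamma> ?e)"
    using edge_arc_from_to[of "last xs" "hd xs"] xs ce by auto
  have "path_image g \<inter> path_image h = p ` (set xs \<inter> ?e)"
    using drawn_Int[of "path_edges xs" "{?e}"] e xs ce Union_path_edges[of xs]
    by (simp add: h(4) g(4) drawn_def)
  then have "path_image g \<inter> path_image h \<subseteq> {pathstart g, pathstart h}"
    using g h by auto
  then have "simple_path (g +++ h)" using g h by (intro simple_path_join_loop) auto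
  moreover have "path_image (g +++ h) = drawn \<gamma> (cycle_edges xs)"
    using g h ce by (auto simp: path_image_join drawn_def)
  ultimately show thesis using that[of "g +++ h"] g h by simp
qed

end

text \<open>One, both or neither of the ends may be removed, depending on \<open>S\<close>: an edge inside a cycle can
  have an end on the cycle and its other end off it.\<close>

lemma connected_arc_minus_ends:
  fixes g :: "real \<Rightarrow> 'b :: real_normed_vector"
  assumes "arc g" "path_image g \<inter> S \<subseteq> {pathstart g, pathfinish g}"
  shows "connected (path_image g - S)"
proof -
  define T where "T = {t \<in> {0..1}. g t \<notin> S}"
  have "{0<..<1} \<subseteq> T"
  proof
    fix t :: real assume t: "t \<in> {0<..<1}"
    then have "g t \<in> path_image g - {pathstart g, pathfinish g}"
      using simple_path_endless[OF arc_imp_simple_path[OF assms(1)]] by blast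
    then show "t \<in> T" using assms(2) t by (auto simp: T_def)
  qed
  moreover have "T \<subseteq> closure {0<..<1}" by (auto simp: T_def)
  ultimately have "connected T" by (rule connected_intermediate_closure[OF connected_Ioo])
  moreover have "continuous_on T g"
    using arc_imp_path[OF assms(1)] unfolding path_def
    by (rule continuous_on_subset) (auto simp: T_def)
  moreover have "path_image g - S = g ` T" by (auto simp: T_def path_image_def)
  ultimately show ?thesis by (simp add: connected_continuous_image)
qed

text \<open>Both regions are unions of components of the complement of \<open>S\<close>.\<close>

lemma connected_inside_or_outside:
  assumes "connected A" "A \<inter> S = {}"
  shows "A \<subseteq> inside S \<or> A \<subseteq> outside S"
proof (rule ccontr)
  assume *: "\<not> ?thesis"
  then obtain x where x: "x \<in> A" "x \<notin> outside S" by blast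
  then have "x \<in> inside S" using assms(2) inside_Un_outside[of S] by blast
  moreover have "connected_component (- S) x y" if "y \<in> A" for y
    unfolding connected_component_def using assms x that by blast
  ultimately have "A \<subseteq> inside S" using inside_same_component by blast
  then show False using * by blast
qed

lemma edge_inside_or_outside:
  assumes "plane_edges E p \<gamma>" "X \<subseteq> E" "e \<in> E"
  shows "path_image (\<gamma> e) \<subseteq> drawn \<gamma> X \<union> inside (drawn \<gamma> X) \<or>
         path_image (\<gamma> e) \<subseteq> drawn \<gamma> X \<union> outside (drawn \<gamma> X)"
proof (cases "e \<in> X")
  case True
  then show ?thesis using path_image_subset_drawn[of e X \<gamma>] by blast
next
  case False
  have "connected (path_image (\<gamma> e) - drawn \<gamma> X)"
    using path_image_Int_drawn[OF assms False] plane_arc(1)[OF assms(1,3)]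
    by (intro connected_arc_minus_ends)
  then show ?thesis using connected_inside_or_outside[of "path_image (\<gamma> e) - drawn \<gamma> X"]
    by blast
qed


section \<open>Turning the outside of a closed curve into an inside\<close>

text \<open>The component of the image of \<open>z\<close> corresponds, up to the point \<open>0\<close>, to a connected set outside \<open>S\<close>.
  That set keeps a positive distance from \<open>a\<close>, which is inside, so the component is bounded.\<close>

lemma inversion_maps_outside_to_inside:
  fixes a :: complex
  assumes S: "compact S" and a: "a \<in> inside S" and z: "z \<in> outside S"
  shows "inverse (z - a) \<in> inside ((\<lambda>z. inverse (z - a)) ` S)"
proof -
  \<comment> \<open>As \<open>inverse 0 = 0\<close>, the map is injective on the whole plane, and continuous except at \<open>a\<close>.\<close>
  define f where "f = (\<lambda>z :: complex. inverse (z - a))"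
  have inj: "inj f" by (auto simp: f_def inj_def)
  have "a \<notin> S" using a inside_no_overlap by blast
  then have "compact (f ` S)"
    unfolding f_def using S by (intro compact_continuous_image continuous_intros) auto
  then have op: "open (- f ` S)" by (simp add: compact_imp_closed open_Compl)
  have zS: "z \<notin> S" using z outside_no_overlap by blast
  have fz: "f z \<notin> f ` S" using inj zS by (auto dest: injD)
  have "z \<noteq> a" using a z inside_Int_outside by blast
  define K where "K = connected_component_set (- f ` S) (f z)"
  have K: "open K" "connected K" "K \<subseteq> - f ` S" "f z \<in> K"
    using op fz connected_component_subset[of "- f ` S" "f z"]
    by (auto simp: K_def open_connected_component)
  \<comment> \<open>Pulling \<open>K\<close> back is possible after removing \<open>0\<close>, the image of the point at infinity. Removing a
    point does not disconnect an open connected set of the plane.\<close>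
  define L where "L = (\<lambda>w. a + inverse w) ` (K - {0})"
  have "connected (K - {0})" using K by (intro connected_open_delete) auto
  then have "connected L" unfolding L_def
    by (intro connected_continuous_image continuous_intros) auto
  moreover have "L \<subseteq> - S"
  proof
    fix s assume "s \<in> L"
    then obtain w where w: "w \<in> K" "s = a + inverse w" by (auto simp: L_def)
    then have "f s = w" by (simp add: f_def)
    moreover have "w \<notin> f ` S" using w K(3) by blast
    ultimately show "s \<in> - S" by blast
  qed
  moreover have "z \<in> L"
    unfolding L_def using K(4) \<open>z \<noteq> a\<close>
    by (intro image_eqI[of _ _ "f z"]) (auto simp: f_def)
  ultimately have "L \<subseteq> outside S"
    using connected_inside_or_outside[of L S] z inside_Int_outside by blast
  obtain r where r: "0 < r" "ball a r \<subseteq> inside S"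
    using a open_inside[OF compact_imp_closed[OF S]] open_contains_ball by blast
  have "norm w \<le> 1 / r" if "w \<in> K" for w
  proof (cases "w = 0")
    case False
    then have "a + inverse w \<in> outside S" using that \<open>L \<subseteq> outside S\<close> by (auto simp: L_def)
    then have "a + inverse w \<notin> ball a r" using r inside_Int_outside by blast
    then have "r \<le> 1 / norm w" by (simp add: dist_norm norm_inverse divide_inverse)
    then show ?thesis using False r by (simp add: field_simps)
  qed (use r in simp)
  then have "bounded K" by (auto simp: bounded_iff)
  then show ?thesis using fz unfolding inside_def K_def f_def by simp
qed

lemma plane_edges_inversion:
  assumes pl: "plane_edges E p \<gamma>" and a: "a \<notin> drawn \<gamma> E"
  shows "plane_edges E (\<lambda>v. inverse (p v - a)) (\<lambda>e t. inverse (\<gamma> e t - a))"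
proof -
  define f where "f = (\<lambda>z :: complex. inverse (z - a))"
  have inj: "inj_on f A" for A by (auto simp: f_def inj_on_def)
  have im: "path_image (f \<circ> \<gamma> e) = f ` path_image (\<gamma> e)" for e by (rule path_image_compose)
  have p: "(f \<circ> p) ` A = f ` p ` A" for A by (simp add: image_comp)
  have "arc (f \<circ> \<gamma> e)" if "e \<in> E" for e
  proof -
    have "continuous_on (path_image (\<gamma> e)) f"
      unfolding f_def using a path_image_subset_drawn[OF that, of \<gamma>]
      by (intro continuous_intros) auto
    then show ?thesis
      using plane_arc(1)[OF pl that] inj
      by (auto simp: arc_def path_continuous_image path_image_def intro!: comp_inj_on)
  qed
  moreover have "{pathstart (f \<circ> \<gamma> e), pathfinish (f \<circ> \<gamma> e)} = (f \<circ> p) ` e" if "e \<in> E" for e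
    using arg_cong[OF plane_arc(2)[OF pl that], of "image f"] unfolding p
    by (simp add: pathstart_def pathfinish_def)
  moreover have "path_image (f \<circ> \<gamma> e) \<inter> (f \<circ> p) ` \<Union> E = (f \<circ> p) ` e" if "e \<in> E" for e
    unfolding im p plane_arc(3)[OF pl that, symmetric]
    by (rule inj_on_image_Int[OF inj[of UNIV], symmetric]) auto
  moreover have "path_image (f \<circ> \<gamma> e) \<inter> path_image (f \<circ> \<gamma> e') = (f \<circ> p) ` (e \<inter> e')"
    if "e \<in> E" "e' \<in> E" "e \<noteq> e'" for e e'
    unfolding im p plane_crossing[OF pl that, symmetric]
    by (rule inj_on_image_Int[OF inj[of UNIV], symmetric]) auto
  moreover have "inj_on (f \<circ> p) (\<Union> E)"
    using plane_inj[OF pl] inj by (rule comp_inj_on)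
  ultimately have "plane_edges E (f \<circ> p) (\<lambda>e. f \<circ> \<gamma> e)"
    using plane_finite(1)[OF pl] plane_card[OF pl]
    unfolding plane_edges_def plane_drawing_def fst_conv snd_conv by (intro conjI ballI impI)
  then show ?thesis by (simp add: f_def comp_def)
qed

lemma drawn_inversion:
  "drawn (\<lambda>e t. inverse (\<gamma> e t - a)) X = (\<lambda>z. inverse (z - a)) ` drawn \<gamma> X"
  by (auto simp: drawn_def path_image_def)


section \<open>Cutting a disc along an ear\<close>

text \<open>Three paths from \<open>a\<close> to \<open>b\<close> that are otherwise disjoint form a theta graph. If \<open>P\<close> runs inside the
  cycle formed by \<open>c1\<close> and \<open>c2\<close>, the two cycles through \<open>P\<close> have disjoint insides that, together
  with \<open>P\<close>, fill the inside of the large cycle. So every edge falls on one side of \<open>P\<close>, and the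
  two sides share the edges and the vertices of \<open>P\<close> only.\<close>

lemma theta_split:
  fixes c1 c2 P :: "'a list"
  assumes pl: "plane_edges E p \<gamma>"
    and paths: "\<And>Q. Q \<in> {c1, c2, P} \<Longrightarrow>
      distinct Q \<and> 2 \<le> length Q \<and> hd Q = a \<and> last Q = b \<and> path_edges Q \<subseteq> E"
    and verts: "set c1 \<inter> set c2 = {a, b}" "set c1 \<inter> set P = {a, b}" "set c2 \<inter> set P = {a, b}"
    and disj: "path_edges c1 \<inter> path_edges c2 = {}" "path_edges c1 \<inter> path_edges P = {}"
      "path_edges c2 \<inter> path_edges P = {}"
    and disc: "\<And>e. e \<in> E \<Longrightarrow> path_image (\<gamma> e) \<subseteq>
      drawn \<gamma> (path_edges c1 \<union> path_edges c2) \<union> inside (drawn \<gamma> (path_edges c1 \<union> path_edges c2))"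
  obtains E1 E2 where "E1 \<union> E2 = E" "E1 \<inter> E2 = path_edges P" "\<Union> E1 \<inter> \<Union> E2 = set P"
    "path_edges c1 \<union> path_edges P \<subseteq> E1" "path_edges c2 \<union> path_edges P \<subseteq> E2"
    "\<And>e. e \<in> E1 \<Longrightarrow> path_image (\<gamma> e) \<subseteq>
      drawn \<gamma> (path_edges c1 \<union> path_edges P) \<union> inside (drawn \<gamma> (path_edges c1 \<union> path_edges P))"
    "\<And>e. e \<in> E2 \<Longrightarrow> path_image (\<gamma> e) \<subseteq>
      drawn \<gamma> (path_edges c2 \<union> path_edges P) \<union> inside (drawn \<gamma> (path_edges c2 \<union> path_edges P))"
proof -
  let ?D = "\<lambda>Q. drawn \<gamma> (path_edges Q)"
  define D1 where "D1 = ?D c1 \<union> ?D P"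
  define D2 where "D2 = ?D c2 \<union> ?D P"
  define D where "D = ?D c1 \<union> ?D c2"
  have E: "path_edges c1 \<subseteq> E" "path_edges c2 \<subseteq> E" "path_edges P \<subseteq> E" using paths by auto
  have U: "\<Union> (path_edges Q) = set Q" if "Q \<in> {c1, c2, P}" for Q
    using paths[OF that] by (intro Union_path_edges) auto
  have arc: "\<exists>g. arc g \<and> pathstart g = p a \<and> pathfinish g = p b \<and> path_image g = ?D Q"
    if "Q \<in> {c1, c2, P}" for Q
    using path_arc[OF pl, of Q] paths[OF that] by metis
  obtain g1 where g1: "arc g1" "pathstart g1 = p a" "pathfinish g1 = p b" "path_image g1 = ?D c1"
    using arc[of c1] by auto
  obtain g2 where g2: "arc g2" "pathstart g2 = p a" "pathfinish g2 = p b" "path_image g2 = ?D c2"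
    using arc[of c2] by auto
  obtain g where g: "arc g" "pathstart g = p a" "pathfinish g = p b" "path_image g = ?D P"
    using arc[of P] by auto
  have "p a \<noteq> p b" using g arc_distinct_ends by force
  have int: "?D c1 \<inter> ?D c2 = {p a, p b}" "?D c1 \<inter> ?D P = {p a, p b}" "?D c2 \<inter> ?D P = {p a, p b}"
    using drawn_Int[OF pl] E disj U verts by simp_all
  have disc': "path_image (\<gamma> e) \<subseteq> D \<union> inside D" if "e \<in> E" for e
    using disc[OF that] by (simp add: drawn_Un D_def)
  have "path_edges P \<noteq> {}" using U[of P] paths[of P] by force
  then obtain e where e: "e \<in> path_edges P" by blast
  \<comment> \<open>One edge of \<open>P\<close> suffices to see that \<open>P\<close> enters the inside of the large cycle.\<close>
  then have eE: "e \<in> E" "e \<notin> path_edges c1 \<union> path_edges c2" using E disj by blast+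
  then have "\<not> path_image (\<gamma> e) \<subseteq> D"
    using edge_in_if_drawn[OF pl, of "path_edges c1 \<union> path_edges c2" e] E
    unfolding D_def drawn_Un by blast
  moreover have "path_image (\<gamma> e) \<subseteq> ?D P" using e by (rule path_image_subset_drawn)
  ultimately have meet: "?D P \<inter> inside D \<noteq> {}" using disc' eE(1) by blast
  have split: "inside D1 \<inter> inside D2 = {}" "inside D1 \<union> inside D2 \<union> (?D P - {p a, p b}) = inside D"
    using split_inside_simple_closed_curve[OF
      arc_imp_simple_path[OF g1(1)] g1(2,3) arc_imp_simple_path[OF g2(1)] g2(2,3)
      arc_imp_simple_path[OF g(1)] g(2,3) \<open>p a \<noteq> p b\<close>]
      int meet g1(4) g2(4) g(4) unfolding D_def D1_def D2_def by metis+
  define E1 where "E1 = {e \<in> E. path_image (\<gamma> e) \<subseteq> D1 \<union> inside D1}"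
  define E2 where "E2 = {e \<in> E. path_image (\<gamma> e) \<subseteq> D2 \<union> inside D2}"
  have C1: "path_edges c1 \<union> path_edges P \<subseteq> E1"
    using E path_image_subset_drawn[of _ "path_edges c1" \<gamma>] path_image_subset_drawn[of _ "path_edges P" \<gamma>]
    unfolding E1_def D1_def by blast
  have C2: "path_edges c2 \<union> path_edges P \<subseteq> E2"
    using E path_image_subset_drawn[of _ "path_edges c2" \<gamma>] path_image_subset_drawn[of _ "path_edges P" \<gamma>]
    unfolding E2_def D2_def by blast
  \<comment> \<open>The two closed discs meet in \<open>P\<close>; the intersection of \<open>c1\<close> and \<open>c2\<close> consists of the ends of \<open>P\<close>.\<close>
  have overlap: "(D1 \<union> inside D1) \<inter> (D2 \<union> inside D2) \<subseteq> ?D P"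
  proof -
    have "inside D1 \<inter> ?D c2 = {}" "inside D2 \<inter> ?D c1 = {}"
      using split(2) inside_no_overlap[of D] unfolding D_def by blast+
    moreover have "inside D1 \<inter> ?D P = {}" "inside D2 \<inter> ?D P = {}"
      using inside_no_overlap[of D1] inside_no_overlap[of D2] unfolding D1_def D2_def by blast+
    moreover have "?D c1 \<inter> ?D c2 \<subseteq> ?D P" using int by blast
    ultimately show ?thesis using split(1) unfolding D1_def D2_def by blast
  qed
  show thesis
  proof
    show "E1 \<union> E2 = E"
    proof
      show "E \<subseteq> E1 \<union> E2"
      proof (rule ccontr)
        assume "\<not> E \<subseteq> E1 \<union> E2"
        then obtain e where e: "e \<in> E" "e \<notin> E1" "e \<notin> E2" by blast
        have "path_image (\<gamma> e) \<subseteq> D1 \<union> outside D1"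
          using edge_inside_or_outside[OF pl, of "path_edges c1 \<union> path_edges P" e] E e
          unfolding E1_def D1_def drawn_Un by blast
        moreover have "path_image (\<gamma> e) \<subseteq> D2 \<union> outside D2"
          using edge_inside_or_outside[OF pl, of "path_edges c2 \<union> path_edges P" e] E e
          unfolding E2_def D2_def drawn_Un by blast
        moreover have "\<not> path_image (\<gamma> e) \<subseteq> ?D c1 \<union> ?D c2 \<union> ?D P"
          using edge_in_if_drawn[OF pl, of "path_edges c1 \<union> path_edges c2 \<union> path_edges P" e]
            E e C1 C2 unfolding drawn_Un by blast
        ultimately obtain z where z: "z \<in> path_image (\<gamma> e)" "z \<in> outside D1" "z \<in> outside D2"
            "z \<notin> ?D c1 \<union> ?D c2 \<union> ?D P"
          unfolding D1_def D2_def by blast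
        have "z \<notin> inside D1" "z \<notin> inside D2"
          using z inside_Int_outside[of D1] inside_Int_outside[of D2] by blast+
        then have "z \<notin> inside D" using split(2) z by blast
        then show False using disc'[OF e(1)] z unfolding D_def by blast
      qed
    qed (auto simp: E1_def E2_def)
    show "E1 \<inter> E2 = path_edges P"
    proof
      show "E1 \<inter> E2 \<subseteq> path_edges P"
      proof
        fix e assume "e \<in> E1 \<inter> E2"
        then have "e \<in> E" "path_image (\<gamma> e) \<subseteq> ?D P"
          using overlap unfolding E1_def E2_def by blast+
        then show "e \<in> path_edges P" using edge_in_if_drawn[OF pl] E by blast
      qed
    qed (use C1 C2 in blast)
    show "\<Union> E1 \<inter> \<Union> E2 = set P"
    proof
      show "\<Union> E1 \<inter> \<Union> E2 \<subseteq> set P"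
      proof
        fix v assume "v \<in> \<Union> E1 \<inter> \<Union> E2"
        then obtain e1 e2 where e: "e1 \<in> E1" "e2 \<in> E2" "v \<in> e1" "v \<in> e2" by blast
        have eE: "e1 \<in> E" "e2 \<in> E" using e unfolding E1_def E2_def by blast+
        have "p v \<in> path_image (\<gamma> e1)" "p v \<in> path_image (\<gamma> e2)"
          using vertex_in_path_image[OF pl] e eE by blast+
        then have "p v \<in> ?D P" using overlap e unfolding E1_def E2_def by blast
        moreover have "v \<in> \<Union> E" using e eE by blast
        ultimately show "v \<in> set P" using vertex_in_drawn_iff[OF pl E(3)] U[of P] by simp
      qed
      have "set P = \<Union> (path_edges P)" using U by simp
      then show "set P \<subseteq> \<Union> E1 \<inter> \<Union> E2" using C1 C2 by blast
    qed
  qed (use C1 C2 in \<open>auto simp: E1_def E2_def D1_def D2_def drawn_Un\<close>)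
qed


section \<open>The edge bound for plane graphs without short cycles\<close>

lemma card_edges_vertices_Un:
  assumes "finite E1" "finite E2" "finite (\<Union> E1)" "finite (\<Union> E2)"
  shows "card E1 + card E2 = card (E1 \<union> E2) + card (E1 \<inter> E2)"
    "card (\<Union> E1) + card (\<Union> E2) = card (\<Union> (E1 \<union> E2)) + card (\<Union> E1 \<inter> \<Union> E2)"
  using card_Un_Int[OF assms(1,2)] card_Un_Int[OF assms(3,4)] by simp_all

text \<open>Equality holds when every bounded face is a \<open>g\<close>-gon. Splitting along an ear with \<open>l\<close> edges keeps the
  bound exactly: the two parts share \<open>l\<close> edges and \<open>l + 1\<close> vertices, and the lengths of their
  boundary cycles add up to \<open>length xs + 2 * l\<close>. The assumption \<open>smaller\<close> is the induction hypothesis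
  of the bound for arbitrary plane graphs below, applied to parts that are split off; it ranges over
  all drawings because the drawing in question may be an inverted one.\<close>

lemma plane_disc_edge_bound:
  fixes E :: "'a set set" and g N :: nat
  assumes smaller: "\<And>(K :: 'a set set) p \<gamma>. plane_edges K p \<gamma> \<Longrightarrow> K \<noteq> {} \<Longrightarrow>
      (\<And>xs. cycle_in K xs \<Longrightarrow> g \<le> length xs) \<Longrightarrow> card K < N \<Longrightarrow>
      g * (card K + 1) \<le> g * card (\<Union> K) + 2 * card K"
    and "plane_edges E p \<gamma>" "card E \<le> N" "\<And>xs. cycle_in E xs \<Longrightarrow> g \<le> length xs"
    and "cycle_in E xs"
    and "\<And>e. e \<in> E \<Longrightarrow> path_image (\<gamma> e) \<subseteq>
      drawn \<gamma> (cycle_edges xs) \<union> inside (drawn \<gamma> (cycle_edges xs))"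
  shows "g * (card E + 1) + length xs \<le> g * card (\<Union> E) + 2 * card E"
  using assms(2-)
proof (induction "card E" arbitrary: E xs rule: less_induct)
  case less
  note pl = less.prems(1) and girth = less.prems(3) and disc = less.prems(5)
  define C where "C = cycle_edges xs"
  have xs: "distinct xs" "3 \<le> length xs" "C \<subseteq> E"
    using less.prems(4) by (auto simp: cycle_in_def C_def)
  have fin: "finite F" "finite (\<Union> F)" if "F \<subseteq> E" for F
    using plane_finite[OF plane_edges_subset[OF pl that]] by auto
  have UC: "\<Union> C = set xs" using Union_cycle_edges[of xs] xs by (simp add: C_def)
  have card_C: "card C = length xs" "card (\<Union> C) = length xs"
    using card_cycle_edges[of xs] distinct_card[of xs] xs UC by (simp_all add: C_def)
  have sub: "g \<le> length ys" if "F \<subseteq> E" "cycle_in F ys" for F ys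
    using girth[of ys] that by (auto simp: cycle_in_def)
  show ?case
  proof (cases "C = E")
    case True
    then show ?thesis using card_C girth[OF less.prems(4)] by simp
  next
    case False
    consider (ear) P where "2 \<le> length P" "distinct P" "path_edges P \<subseteq> E - C"
        "set P \<inter> \<Union> C = {hd P, last P}"
      | (split) K a where "K \<subseteq> E - C" "K \<noteq> {}" "\<Union> K \<inter> \<Union> (E - K) \<subseteq> {a}"
      by (rule ear_or_split[OF xs(3) False plane_card[OF pl]])
    then show ?thesis
    proof cases
      case (split K a)
      define F where "F = E - K"
      have "C \<noteq> {}" using card_C xs by auto
      then have F: "F \<subset> E" "C \<subseteq> F" "K \<subset> E" "F \<union> K = E" "F \<inter> K = {}"
        using split xs by (auto simp: F_def)
      have "card (\<Union> F \<inter> \<Union> K) \<le> 1"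
        using card_mono[of "{a}" "\<Union> F \<inter> \<Union> K"] split(3) by (auto simp: F_def)
      then have n: "card (\<Union> F) + card (\<Union> K) \<le> card (\<Union> E) + 1"
        and m: "card F + card K = card E"
        using card_edges_vertices_Un[of F K] fin[of F] fin[of K] F by auto
      have "card K < card E" "card F < card E"
        using F fin[of E] by (auto intro: psubset_card_mono)
      then have "g * (card K + 1) \<le> g * card (\<Union> K) + 2 * card K"
        using smaller[OF plane_edges_subset[OF pl, of K]] split(2) F sub[of K] less.prems(2) by auto
      moreover have "g * (card F + 1) + length xs \<le> g * card (\<Union> F) + 2 * card F"
      proof (rule less.hyps)
        have "F \<subseteq> E" using F by blast
        then show "plane_edges F p \<gamma>" "\<And>ys. cycle_in F ys \<Longrightarrow> g \<le> length ys"
          using plane_edges_subset[OF pl] sub by blast+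
        show "cycle_in F xs" using less.prems(4) F(2) by (simp add: cycle_in_def C_def)
        show "path_image (\<gamma> e) \<subseteq> drawn \<gamma> (cycle_edges xs) \<union> inside (drawn \<gamma> (cycle_edges xs))"
          if "e \<in> F" for e by (rule disc[OF subsetD[OF \<open>F \<subseteq> E\<close> that]])
      qed (use \<open>card F < card E\<close> less.prems(2) in simp_all)
      moreover have "g * (card (\<Union> F) + card (\<Union> K)) \<le> g * (card (\<Union> E) + 1)"
        using n by (rule mult_le_mono2)
      moreover have "g * (card F + card K) = g * card E" using m by simp
      ultimately show ?thesis using m unfolding distrib_left by linarith
    next
      case (ear P)
      define a where "a = hd P"
      define b where "b = last P"
      obtain us where us: "P = a # us" "us \<noteq> []"
        using ear(1) unfolding a_def by (cases P) (auto simp: Suc_le_eq)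
      then obtain qs where "us = qs @ [b]" unfolding b_def by (metis append_butlast_last_id last_ConsR)
      then have P: "P = a # qs @ [b]" using us by simp
      have Pxs: "set P \<inter> set xs = {a, b}" using ear(4) UC by (simp add: a_def b_def)
      have "a \<noteq> b" using ear(2) unfolding P by simp
      moreover have "a \<in> set xs" "b \<in> set xs" using Pxs by blast+
      ultimately obtain ys zs where C: "distinct (a # ys @ b # zs)"
        "set (a # ys @ b # zs) = set xs" "length (a # ys @ b # zs) = length xs"
        "cycle_edges (a # ys @ b # zs) = C"
        unfolding C_def using cycle_through_two_vertices[OF xs(1), of a b] by metis
      \<comment> \<open>The vertices \<open>a\<close> and \<open>b\<close> cut the cycle into the paths \<open>c1\<close> and \<open>c2\<close>, both directed from \<open>a\<close> to \<open>b\<close>.\<close>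
      define c1 where "c1 = a # ys @ [b]"
      define c2 where "c2 = a # rev zs @ [b]"
      have c2: "path_edges c2 = path_edges (b # zs @ [a])"
        using path_edges_rev[of "b # zs @ [a]"] by (simp add: c2_def)
      have C12: "C = path_edges c1 \<union> path_edges c2"
        using C(4) path_edges_append[of "a # ys" b "zs @ [a]"]
        by (simp add: cycle_edges_Cons c1_def c2)
      have dist: "distinct c1" "distinct c2" using C(1) by (auto simp: c1_def c2_def)
      have disjP: "path_edges c1 \<inter> path_edges P = {}" "path_edges c2 \<inter> path_edges P = {}"
        using ear(3) C12 by auto
      \<comment> \<open>Edge-disjointness of the two paths comes from counting.\<close>
      have "card C = card (path_edges c1) + card (path_edges c2)"
        using card_path_edges[OF dist(1)] card_path_edges[OF dist(2)] card_C(1) C(3)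
        by (simp add: c1_def c2_def)
      then have "card (path_edges c1 \<inter> path_edges c2) = 0"
        using card_Un_Int[of "path_edges c1" "path_edges c2"] C12 by simp
      then have disj12: "path_edges c1 \<inter> path_edges c2 = {}" by simp
      have set12: "set c1 \<inter> set c2 = {a, b}" "set c1 \<inter> set P = {a, b}" "set c2 \<inter> set P = {a, b}"
      proof -
        show "set c1 \<inter> set c2 = {a, b}" using C(1) by (auto simp: c1_def c2_def)
        have "A \<inter> set P = {a, b}" if "A \<subseteq> set xs" "a \<in> A" "b \<in> A" for A
        proof (rule equalityI)
          show "A \<inter> set P \<subseteq> {a, b}" using that(1) unfolding Pxs[symmetric] by auto
          show "{a, b} \<subseteq> A \<inter> set P" using that by (simp add: P)
        qed
        moreover have "set c1 \<subseteq> set xs" "set c2 \<subseteq> set xs"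
          unfolding C(2)[symmetric] by (auto simp: c1_def c2_def)
        ultimately show "set c1 \<inter> set P = {a, b}" "set c2 \<inter> set P = {a, b}"
          by (simp_all add: c1_def c2_def)
      qed
      have paths: "distinct Q \<and> 2 \<le> length Q \<and> hd Q = a \<and> last Q = b \<and> path_edges Q \<subseteq> E"
        if "Q \<in> {c1, c2, P}" for Q
        using that dist ear(1-3) xs(3) C12 P by (auto simp: c1_def c2_def)
      obtain E1 E2 where E12: "E1 \<union> E2 = E" "E1 \<inter> E2 = path_edges P" "\<Union> E1 \<inter> \<Union> E2 = set P"
        and C1: "path_edges c1 \<union> path_edges P \<subseteq> E1" and C2: "path_edges c2 \<union> path_edges P \<subseteq> E2"
        and disc1: "\<And>e. e \<in> E1 \<Longrightarrow> path_image (\<gamma> e) \<subseteq> drawn \<gamma> (path_edges c1 \<union> path_edges P) \<union>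
            inside (drawn \<gamma> (path_edges c1 \<union> path_edges P))"
        and disc2: "\<And>e. e \<in> E2 \<Longrightarrow> path_image (\<gamma> e) \<subseteq> drawn \<gamma> (path_edges c2 \<union> path_edges P) \<union>
            inside (drawn \<gamma> (path_edges c2 \<union> path_edges P))"
        using theta_split[OF pl paths set12 disj12 disjP disc[folded C_def, unfolded C12]] by blast
      \<comment> \<open>Either path, followed by the ear backwards, bounds one of the two smaller discs.\<close>
      define x1 where "x1 = a # ys @ b # rev qs"
      define x2 where "x2 = a # rev zs @ b # rev qs"
      have revP: "path_edges (b # rev qs @ [a]) = path_edges P"
        using path_edges_rev[of P] by (simp add: P)
      have x1: "cycle_edges x1 = path_edges c1 \<union> path_edges P"
        using path_edges_append[of "a # ys" b "rev qs @ [a]"] revP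
        by (simp add: x1_def c1_def cycle_edges_Cons)
      have x2: "cycle_edges x2 = path_edges c2 \<union> path_edges P"
        using path_edges_append[of "a # rev zs" b "rev qs @ [a]"] revP
        by (simp add: x2_def c2_def cycle_edges_Cons)
      have "distinct qs" "set qs \<inter> set c1 = {}" "set qs \<inter> set c2 = {}"
        using ear(2) set12(2,3) by (auto simp: P)
      then have dx: "distinct x1" "distinct x2"
        using dist by (auto simp: x1_def x2_def c1_def c2_def)
      \<comment> \<open>The ear and a path of \<open>C\<close> cannot both be single edges, being edge-disjoint.\<close>
      have "ys \<noteq> [] \<or> qs \<noteq> []" "zs \<noteq> [] \<or> qs \<noteq> []"
        using disjP by (auto simp: c1_def c2_def P)
      then have len: "3 \<le> length x1" "3 \<le> length x2"
        by (auto simp: x1_def x2_def Suc_le_eq)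
      have cyc: "cycle_in E1 x1" "cycle_in E2 x2"
        using dx len x1 x2 C1 C2 by (auto simp: cycle_in_def)
      have proper: "E1 \<subset> E" "E2 \<subset> E"
      proof -
        have "path_edges c1 \<noteq> {}" "path_edges c2 \<noteq> {}"
          using path_edges_Cons[of "ys @ [b]" a] path_edges_Cons[of "rev zs @ [b]" a]
          by (auto simp: c1_def c2_def)
        then show "E1 \<subset> E" "E2 \<subset> E" using E12(1,2) C1 C2 disjP by blast+
      qed
      then have cards: "card E1 < card E" "card E2 < card E"
        using fin[of E] by (auto intro: psubset_card_mono)
      have "g * (card E1 + 1) + length x1 \<le> g * card (\<Union> E1) + 2 * card E1"
      proof (rule less.hyps)
        show "path_image (\<gamma> e) \<subseteq> drawn \<gamma> (cycle_edges x1) \<union> inside (drawn \<gamma> (cycle_edges x1))"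
          if "e \<in> E1" for e using disc1[OF that] unfolding x1 .
        show "plane_edges E1 p \<gamma>" "\<And>ys. cycle_in E1 ys \<Longrightarrow> g \<le> length ys"
          using plane_edges_subset[OF pl] sub proper(1) by blast+
      qed (use cards(1) cyc(1) less.prems(2) in simp_all)
      moreover have "g * (card E2 + 1) + length x2 \<le> g * card (\<Union> E2) + 2 * card E2"
      proof (rule less.hyps)
        show "path_image (\<gamma> e) \<subseteq> drawn \<gamma> (cycle_edges x2) \<union> inside (drawn \<gamma> (cycle_edges x2))"
          if "e \<in> E2" for e using disc2[OF that] unfolding x2 .
        show "plane_edges E2 p \<gamma>" "\<And>ys. cycle_in E2 ys \<Longrightarrow> g \<le> length ys"
          using plane_edges_subset[OF pl] sub proper(2) by blast+
      qed (use cards(2) cyc(2) less.prems(2) in simp_all)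
      moreover define l where "l = length qs + 1"
      have "card E1 + card E2 = card E + card (path_edges P)"
        "card (\<Union> E1) + card (\<Union> E2) = card (\<Union> E) + card (set P)"
        using card_edges_vertices_Un[of E1 E2] fin[of E1] fin[of E2] proper E12 by auto
      then have m: "card E1 + card E2 = card E + l"
        and n: "card (\<Union> E1) + card (\<Union> E2) = card (\<Union> E) + l + 1"
        using card_path_edges[OF ear(2)] distinct_card[OF ear(2)] by (simp_all add: P l_def)
      moreover have "length x1 + length x2 = length xs + 2 * l"
        using C(3) by (simp add: x1_def x2_def l_def)
      moreover have "g * (card E1 + card E2) = g * (card E + l)"
        "g * (card (\<Union> E1) + card (\<Union> E2)) = g * (card (\<Union> E) + l + 1)"
        unfolding m n by (rule refl)+
      ultimately show ?thesis unfolding distrib_left by linarith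
    qed
  qed
qed

text \<open>Written with additions only, this is \<open>(g - 2) m \<le> g (n - 1)\<close>. For a graph with a cycle of length \<open>k\<close>,
  the disc bound applies to the edges inside or on it and, after an inversion about a point inside
  the cycle, to those outside or on it. The two parts share the \<open>k\<close> edges and \<open>k\<close> vertices of the
  cycle. A graph without a cycle splits at a vertex, unless it is a single edge.\<close>

lemma plane_edge_bound:
  fixes E :: "'a set set" and g :: nat
  assumes "plane_edges E p \<gamma>" "E \<noteq> {}" "\<And>xs. cycle_in E xs \<Longrightarrow> g \<le> length xs"
  shows "g * (card E + 1) \<le> g * card (\<Union> E) + 2 * card E"
  using assms
proof (induction "card E" arbitrary: E p \<gamma> rule: less_induct)
  case less
  note pl = less.prems(1) and girth = less.prems(3)
  have fin: "finite F" "finite (\<Union> F)" if "F \<subseteq> E" for F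
    using plane_finite[OF plane_edges_subset[OF pl that]] by auto
  have sub: "g \<le> length ys" if "F \<subseteq> E" "cycle_in F ys" for F ys
    using girth[of ys] that by (auto simp: cycle_in_def)
  have cyclic: ?case if cyc: "cycle_in E xs" for xs
  proof -
    define S where "S = drawn \<gamma> (cycle_edges xs)"
    define E1 where "E1 = {e \<in> E. path_image (\<gamma> e) \<subseteq> S \<union> inside S}"
    define E2 where "E2 = {e \<in> E. path_image (\<gamma> e) \<subseteq> S \<union> outside S}"
    have xs: "distinct xs" "3 \<le> length xs" "cycle_edges xs \<subseteq> E"
      using cyc by (auto simp: cycle_in_def)
    have S: "path_image (\<gamma> e) \<subseteq> S" if "e \<in> cycle_edges xs" for e
      using path_image_subset_drawn[OF that] by (simp add: S_def)
    have sub12: "E1 \<subseteq> E" "E2 \<subseteq> E" by (auto simp: E1_def E2_def)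
    have C12: "cycle_edges xs \<subseteq> E1" "cycle_edges xs \<subseteq> E2"
      using xs(3) S by (auto simp: E1_def E2_def)
    then have cyc12: "cycle_in E1 xs" "cycle_in E2 xs" using cyc by (auto simp: cycle_in_def)
    have Un: "E1 \<union> E2 = E"
      using edge_inside_or_outside[OF pl xs(3)] sub12 by (auto simp: E1_def E2_def S_def)
    have overlap: "(S \<union> inside S) \<inter> (S \<union> outside S) = S"
      using inside_Int_outside[of S] by blast
    have Int: "E1 \<inter> E2 = cycle_edges xs"
    proof
      show "E1 \<inter> E2 \<subseteq> cycle_edges xs"
      proof
        fix e assume "e \<in> E1 \<inter> E2"
        then have "e \<in> E" "path_image (\<gamma> e) \<subseteq> S"
          using overlap unfolding E1_def E2_def by blast+
        then show "e \<in> cycle_edges xs" using edge_in_if_drawn[OF pl xs(3)] by (simp add: S_def)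
      qed
    qed (use C12 in blast)
    have Uxs: "\<Union> (cycle_edges xs) = set xs" using Union_cycle_edges[of xs] xs by simp
    have UInt: "\<Union> E1 \<inter> \<Union> E2 = set xs"
    proof
      show "\<Union> E1 \<inter> \<Union> E2 \<subseteq> set xs"
      proof
        fix v assume "v \<in> \<Union> E1 \<inter> \<Union> E2"
        then obtain e1 e2 where e: "e1 \<in> E1" "e2 \<in> E2" "v \<in> e1" "v \<in> e2" by blast
        then have eE: "e1 \<in> E" "e2 \<in> E" using sub12 by blast+
        have "p v \<in> path_image (\<gamma> e1)" "p v \<in> path_image (\<gamma> e2)"
          using vertex_in_path_image[OF pl] e eE by blast+
        then have "p v \<in> S" using overlap e unfolding E1_def E2_def by blast
        moreover have "v \<in> \<Union> E" using e eE by blast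
        ultimately show "v \<in> set xs" using vertex_in_drawn_iff[OF pl xs(3)] Uxs by (simp add: S_def)
      qed
      show "set xs \<subseteq> \<Union> E1 \<inter> \<Union> E2" using C12 Uxs by blast
    qed
    have smaller: "g * (card K + 1) \<le> g * card (\<Union> K) + 2 * card K"
      if "plane_edges K q \<delta>" "K \<noteq> {}" "\<And>xs. cycle_in K xs \<Longrightarrow> g \<le> length xs" "card K < card E"
      for K :: "'a set set" and q \<delta> using less.hyps that by blast
    have le: "card E1 \<le> card E" "card E2 \<le> card E" using sub12 fin[of E] by (auto intro: card_mono)
    have disc1: "path_image (\<gamma> e) \<subseteq> drawn \<gamma> (cycle_edges xs) \<union> inside (drawn \<gamma> (cycle_edges xs))"
      if "e \<in> E1" for e using that by (simp add: E1_def S_def)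
    have in1: "g * (card E1 + 1) + length xs \<le> g * card (\<Union> E1) + 2 * card E1"
      by (rule plane_disc_edge_bound[OF smaller plane_edges_subset[OF pl sub12(1)] le(1)
            sub[OF sub12(1)] cyc12(1) disc1])
    obtain c where c: "simple_path c" "pathfinish c = pathstart c" "path_image c = S"
      using cycle_closed_curve[OF pl cyc] unfolding S_def by blast
    then obtain a where a: "a \<in> inside S" using Jordan_inside_outside by blast
    define \<delta> where "\<delta> = (\<lambda>e t. inverse (\<gamma> e t - a))"
    have "a \<notin> drawn \<gamma> E2"
      using a inside_Int_outside[of S] inside_no_overlap[of S] unfolding drawn_def E2_def by blast
    then have pl2: "plane_edges E2 (\<lambda>v. inverse (p v - a)) \<delta>"
      unfolding \<delta>_def by (rule plane_edges_inversion[OF plane_edges_subset[OF pl sub12(2)]])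
    have S': "drawn \<delta> (cycle_edges xs) = (\<lambda>z. inverse (z - a)) ` S"
      unfolding \<delta>_def S_def by (rule drawn_inversion)
    have "compact S" unfolding S_def by (rule compact_drawn[OF pl xs(3)])
    have disc2: "path_image (\<delta> e) \<subseteq> drawn \<delta> (cycle_edges xs) \<union> inside (drawn \<delta> (cycle_edges xs))"
      if "e \<in> E2" for e
    proof -
      have "path_image (\<delta> e) = (\<lambda>z. inverse (z - a)) ` path_image (\<gamma> e)"
        using drawn_inversion[of \<gamma> a "{e}"] by (simp add: drawn_def \<delta>_def)
      also have "\<dots> \<subseteq> (\<lambda>z. inverse (z - a)) ` (S \<union> outside S)"
        using that by (intro image_mono) (simp add: E2_def)
      also have "\<dots> \<subseteq> drawn \<delta> (cycle_edges xs) \<union> inside (drawn \<delta> (cycle_edges xs))"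
        unfolding S' image_Un
        by (intro Un_mono order_refl image_subsetI
            inversion_maps_outside_to_inside[OF \<open>compact S\<close> a])
      finally show ?thesis .
    qed
    have in2: "g * (card E2 + 1) + length xs \<le> g * card (\<Union> E2) + 2 * card E2"
      by (rule plane_disc_edge_bound[OF smaller pl2 le(2) sub[OF sub12(2)] cyc12(2) disc2])
    have "card E1 + card E2 = card E + length xs"
      "card (\<Union> E1) + card (\<Union> E2) = card (\<Union> E) + length xs"
      using card_edges_vertices_Un[of E1 E2] fin[OF sub12(1)] fin[OF sub12(2)] Un Int UInt
        card_cycle_edges[OF xs(1,2)] distinct_card[OF xs(1)] by simp_all
    moreover from this have "g * (card E1 + card E2) = g * (card E + length xs)"
      "g * (card (\<Union> E1) + card (\<Union> E2)) = g * (card (\<Union> E) + length xs)"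
      by simp_all
    ultimately show ?thesis using in1 in2 unfolding distrib_left by linarith
  qed
  \<comment> \<open>An ear of the single edge \<open>e\<close> is a path between its ends that avoids it, hence closes up to a cycle.\<close>
  obtain e where e: "e \<in> E" using less.prems(2) by blast
  show ?case
  proof (cases "{e} = E")
    case True
    then have "card E = 1" "card (\<Union> E) = 2" using plane_card[OF pl e] by auto
    then show ?thesis by simp
  next
    case False
    have "{e} \<subseteq> E" using e by simp
    then consider (ear) P where "2 \<le> length P" "distinct P" "path_edges P \<subseteq> E - {e}"
        "set P \<inter> \<Union> {e} = {hd P, last P}"
      | (split) K a where "K \<subseteq> E - {e}" "K \<noteq> {}" "\<Union> K \<inter> \<Union> (E - K) \<subseteq> {a}"
      by (rule ear_or_split[OF _ False plane_card[OF pl]])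
    then show ?thesis
    proof cases
      case (ear P)
      have "hd P \<noteq> last P" using ear(1,2) by (cases P) (auto simp: Suc_le_eq)
      moreover have "{hd P, last P} \<subseteq> e" using ear(4) by auto
      moreover have "finite e" "card e = 2" using plane_card[OF pl e] by (auto intro: card_ge_0_finite)
      ultimately have ends: "e = {hd P, last P}" by (metis card_2_iff card_subset_eq)
      have "length P \<noteq> 2"
      proof
        assume "length P = 2"
        then have "path_edges P = {e}" using ends by (auto simp: numeral_2_eq_2 length_Suc_conv)
        then show False using ear(3) by blast
      qed
      moreover have "P \<noteq> []" using ear(1) by auto
      then have "cycle_edges P = insert e (path_edges P)"
        unfolding cycle_edges_def ends by (simp add: path_edges_snoc insert_commute)
      ultimately have "cycle_in E P" using ear(1-3) e by (auto simp: cycle_in_def)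
      then show ?thesis by (rule cyclic)
    next
      case (split K a)
      define F where "F = E - K"
      have F: "F \<subset> E" "F \<noteq> {}" "K \<subset> E" "F \<union> K = E" "F \<inter> K = {}"
        using split e by (auto simp: F_def)
      have "card (\<Union> F \<inter> \<Union> K) \<le> 1"
        using card_mono[of "{a}" "\<Union> F \<inter> \<Union> K"] split(3) by (auto simp: F_def)
      then have n: "card (\<Union> F) + card (\<Union> K) \<le> card (\<Union> E) + 1"
        and m: "card F + card K = card E"
        using card_edges_vertices_Un[of F K] fin[of F] fin[of K] F by auto
      have "card K < card E" "card F < card E"
        using F fin[of E] by (auto intro: psubset_card_mono)
      then have "g * (card K + 1) \<le> g * card (\<Union> K) + 2 * card K"
        "g * (card F + 1) \<le> g * card (\<Union> F) + 2 * card F"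
        using less.hyps[OF _ plane_edges_subset[OF pl, of K]] split(2) F sub[of K]
          less.hyps[OF _ plane_edges_subset[OF pl, of F]] sub[of F] by auto
      moreover have "g * (card (\<Union> F) + card (\<Union> K)) \<le> g * (card (\<Union> E) + 1)"
        using n by (rule mult_le_mono2)
      moreover have "g * (card F + card K) = g * card E" using m by simp
      ultimately show ?thesis using m unfolding distrib_left by linarith
    qed
  qed
qed

text \<open>With all degrees at least \<open>3\<close>, the handshake lemma gives \<open>3 n \<le> 2 m\<close>, which contradicts the edge
  bound \<open>4 m \<le> 6 (n - 1)\<close>.\<close>

lemma plane_girth6_degree2:
  assumes pl: "plane_edges E p \<gamma>" and "E \<noteq> {}" "\<And>xs. cycle_in E xs \<Longrightarrow> 6 \<le> length xs"
  shows "\<exists>v \<in> \<Union> E. card {e \<in> E. v \<in> e} \<le> 2"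
proof (rule ccontr)
  assume *: "\<not> ?thesis"
  have "3 \<le> card {e \<in> E. v \<in> e}" if "v \<in> \<Union> E" for v
  proof -
    have "\<not> card {e \<in> E. v \<in> e} \<le> 2" using * that by blast
    then show ?thesis by simp
  qed
  then have "card (\<Union> E) * 3 \<le> (\<Sum>v \<in> \<Union> E. card {e \<in> E. v \<in> e})"
    using sum_bounded_below[of "\<Union> E" 3 "\<lambda>v. card {e \<in> E. v \<in> e}"] by simp
  also have "\<dots> = 2 * card E"
    using plane_finite(1)[OF pl] plane_card[OF pl] by (rule handshake)
  finally have "card (\<Union> E) * 3 \<le> 2 * card E" .
  moreover have "6 * (card E + 1) \<le> 6 * card (\<Union> E) + 2 * card E"
    using assms by (rule plane_edge_bound)
  ultimately show False by simp
qed

section \<open>Uniquely restricted colorings of planar graphs\<close>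

lemma planar_girth6_ur_chromatic_index_le:
  assumes G: "simple_graph G" and "planar G" "6 \<le> girth G"
  shows "ur_chromatic_index G \<le> 2 * max_degree G"
proof (rule ur_chromatic_index_le[OF G])
  fix F assume F: "F \<subseteq> edges G" "F \<noteq> {}"
  obtain p \<gamma> where pd: "plane_drawing G p \<gamma>" using assms(2) by (auto simp: planar_def)
  have E: "e \<subseteq> verts G" "card e = 2" if "e \<in> edges G" for e
    using G that by (auto simp: simple_graph_def)
  have "plane_edges (edges G) p \<gamma>"
  proof -
    have sub: "\<Union> (edges G) \<subseteq> verts G" using E by blast
    have "finite (edges G)"
      using G by (auto simp: simple_graph_def intro: finite_subset[of _ "Pow (verts G)"])
    moreover have "inj_on p (\<Union> (edges G))"
      using pd sub by (auto simp: plane_drawing_def intro: inj_on_subset)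
    moreover have "path_image (\<gamma> e) \<inter> p ` \<Union> (edges G) = p ` e" if e: "e \<in> edges G" for e
    proof -
      have "path_image (\<gamma> e) \<inter> p ` verts G = p ` e" using pd e by (simp add: plane_drawing_def)
      moreover have "p ` e \<subseteq> p ` \<Union> (edges G)" "p ` \<Union> (edges G) \<subseteq> p ` verts G"
        using e sub by (auto intro!: image_mono)
      ultimately show ?thesis by blast
    qed
    ultimately show ?thesis using pd E(2) unfolding plane_edges_def plane_drawing_def by simp
  qed
  then have "plane_edges F p \<gamma>" using F(1) by (rule plane_edges_subset)
  moreover have "6 \<le> length xs" if "cycle_in F xs" for xs
  proof -
    have "cycle_in (edges G) xs" using that F(1) by (auto simp: cycle_in_def)
    then have "is_cycle G xs" by (rule is_cycle_if_cycle_in)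
    then have "girth G \<le> enat (length xs)" unfolding girth_def by (intro INF_lower) simp
    then have "enat 6 \<le> enat (length xs)" using assms(3) order.trans by (fastforce simp: numeral_eq_enat)
    then show ?thesis by simp
  qed
  ultimately show "\<exists>v \<in> \<Union> F. card {e \<in> F. v \<in> e} \<le> 2" using F(2) by (intro plane_girth6_degree2)
qed

theorem corollary1p5:
  fixes G :: "'a graph"
  assumes "simple_graph G" and "planar G"
  shows "(girth G = 7 \<longrightarrow> ur_chromatic_index G \<le> 2 * max_degree G + 4) \<and>
         (girth G \<ge> 8 \<longrightarrow> ur_chromatic_index G \<le> 2 * max_degree G + 2)"
proof -
  have "ur_chromatic_index G \<le> 2 * max_degree G" if "6 \<le> girth G"
    using assms that by (rule planar_girth6_ur_chromatic_index_le)
  moreover have "(6 :: enat) \<le> 7" "(6 :: enat) \<le> 8" by simp_all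
  ultimately show ?thesis by (metis order.trans trans_le_add1)
qed

end
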